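(* Let $T\in\mathcal D$ be a target concept and fix $r\in\mathbb N$. Suppose there exist $d\in\mathbb N$ and a map $G_d:[\Delta\times\{0,1\}]^d\to\mathcal D$ such that, for every $m\ge d+r$, writing $H_{I_d}=G_d\big(\{(\delta_i,\mathbf 1_T(\delta_i))\}_{i\in I_d}\big)$: (1) for all $I_r\in\mathcal I_r$ and all $I_d\in\mathcal I_d^{m-r}$, $H_{I_d}$ is consistent with $\{(\delta_i,\mathbf 1_T(\delta_i))\}_{i\in I_d}$; (2) with $\mathbb P^m$-probability one, for all $I_r\in\mathcal I_r$ there exists a unique $I_d\in\mathcal I_d^{m-r}$ such that $H_{I_d}$ is consistent with $\{(\delta_i,\mathbf 1_T(\delta_i))\}_{i\in\{1,\ldots,m\}\setminus I_r}$; (3) with $\mathbb P^m$-probability one, there exists $I_r\in\mathcal I_r$ such that for the $I_d\in\mathcal I_d^{m-r}$ for which $H_{I_d}$ is consistent with $\{(\delta_i,\mathbf 1_T(\delta_i))\}_{i\in\{1,\ldots,m\}\setminus I_r}$, one has $\mathbf 1_{H_{I_d}}(\delta_i)\neq\mathbf 1_T(\delta_i)$ for all $i\in I_r$. Denote by $\bar I_r\in\mathcal I_r$ a set of indices as in (3), and let $\bar m_d^r$ be a map assigning to each labeled $m$-multisample a set of $d$ indices in $\{1,\dots,m\}\setminus\bar I_r$ such that $G_d\big(\{(\delta_i,\mathbf 1_T(\delta_i))\}_{i\in\bar m_d^r}\big)$ is consistent with $\{(\delta_i,\mathbf 1_T(\delta_i))\}_{i\in\{1,\ldots,m\}\setminus\bar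 I_r}$ and is not consistent with $(\delta_i,\mathbf 1_T(\delta_i))$ for all $i\in\bar I_r$ (i.e. it mislabels every $\delta_i$, $i\in\bar I_r$). Let $A_m\big(\{(\delta_i,\mathbf 1_T(\delta_i))\}_{i=1}^m\big)=H_m:=G_d\big(\{(\delta_i,\mathbf 1_T(\delta_i))\}_{i\in\bar m_d^r}\big)$. Then the algorithm $\{A_m\}_{m\ge d+r}$ is PAC-T with $q(m,\epsilon)=\binom{r+d-1}{r}\sum_{i=0}^{r+d-1}\binom{m}{i}\epsilon^i(1-\epsilon)^{m-i}$, i.e. $\lim_{m\to\infty}q(m,\epsilon)=0$ for each $\epsilon\in(0,1)$ and, for any $\epsilon\in(0,1)$ and $m\ge d+r$, $$\mathbb P^m\Big\{(\delta_1,\ldots,\delta_m)\in\Delta^m:\ d_{\mathbb P}(T,H_m)>\epsilon\Big\}\le\binom{r+d-1}{r}\sum_{i=0}^{r+d-1}\binom{m}{i}\epsilon^i(1-\epsilon)^{m-i}.$$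
   Context: $\Delta\subseteq\mathbb R^{n_\delta}$ is a set endowed with a $\sigma$-algebra $\mathcal D$, $\mathbb P$ is a probability measure on $\mathcal D$, and $\mathbb P^m$ is the product measure on $\Delta^m$ (so $\delta_1,\dots,\delta_m$ are i.i.d. with law $\mathbb P$). $\mathbb N$ denotes the positive integers. All involved sets are assumed measurable. Elements of $\mathcal D$ are called concepts or hypotheses; $T\in\mathcal D$ is a fixed target concept; $\mathbf 1_C$ is the indicator function of $C$. A labeled $m$-multisample is $\{(\delta_i,\mathbf 1_T(\delta_i))\}_{i=1}^m\in[\Delta\times\{0,1\}]^m$. For an index set $J$, a hypothesis $H\in\mathcal D$ is consistent with $\{(\delta_i,\mathbf 1_T(\delta_i))\}_{i\in J}$ iff $\mathbf 1_H(\delta_i)=\mathbf 1_T(\delta_i)$ for all $i\in J$. The error is $d_{\mathbb P}(T,H)=\mathbb P(\{\delta\in\Delta:\mathbf 1_H(\delta)\ne\mathbf 1_T(\delta)\})$. $\mathcal I_r$ is the set of all subsets of $\{1,\dots,m\}$ with $r$ elements. Given $I_r\in\mathcal I_r$, $\mathcal I_d^{m-r}$ is the set of all $\binom{m-r}{d}$ subsets $I_d$ of $\{1,\dots,m\}\setminus I_r$ with $d$ elements. When $G_d$ is applied to samples indexed by $I_d$, they are listed in increasing order of index. PAC-T: an algorithm is a family of maps $A_m:[\Delta\times\{0,1\}]^m\to\mathcal D$, $m\ge m_0$, and $H_m$ is the hypothesis returned by $A_m$ on the labeled $m$-multisample. It is PAC-T with $q(m,\epsilon)$ if for all $\epsilon\in(0,1)$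 and $m\ge m_0$, $\mathbb P^m\{d_{\mathbb P}(T,H_m)>\epsilon\}\le q(m,\epsilon)$, with $\lim_{m\to\infty}q(m,\epsilon)=0$ for each $\epsilon$. *)

theory Defs
  imports "HOL-Probability.Probability" "HOL-Library.Ramsey"
begin

text \<open>
  A concept class, its domain and the law of the samples are bundled in one measure \<open>M\<close>:
  the domain is \<open>space M\<close>, the concepts are the elements of \<open>sets M\<close>. Labels in \<open>{0,1}\<close> are
  represented by \<^typ>\<open>bool\<close>, so that the value of the indicator of \<open>C\<close> at \<open>x\<close> is \<open>x \<in> C\<close>.
  A multisample of size \<open>m\<close> is a point \<open>\<omega>\<close> of the product space over the index set \<open>{1..m}\<close>.
\<close>

abbreviation multisamples :: "'a measure \<Rightarrow> nat \<Rightarrow> (nat \<Rightarrow> 'a) measure" where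
  "multisamples M m \<equiv> PiM {1..m} (\<lambda>_. M)"

definition labeled_lists :: "'a measure \<Rightarrow> nat \<Rightarrow> ('a \<times> bool) list set" where
  "labeled_lists M n = {xs. length xs = n \<and> set xs \<subseteq> space M \<times> UNIV}"

text \<open>The samples with index in the finite set \<open>J\<close>, in increasing order of index.\<close>

definition labeled :: "'a set \<Rightarrow> (nat \<Rightarrow> 'a) \<Rightarrow> nat set \<Rightarrow> ('a \<times> bool) list" where
  "labeled T \<omega> J = map (\<lambda>i. (\<omega> i, \<omega> i \<in> T)) (sorted_list_of_set J)"

definition consistent :: "'a set \<Rightarrow> (nat \<Rightarrow> 'a) \<Rightarrow> nat set \<Rightarrow> 'a set \<Rightarrow> bool" where
  "consistent T \<omega> J H \<longleftrightarrow> (\<forall>i\<in>J. (\<omega> i \<in> H) = (\<omega> i \<in> T))"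

text \<open>This is stronger than the negation of \<^const>\<open>consistent\<close>: every sample is mislabeled.\<close>

definition mislabels_all :: "'a set \<Rightarrow> (nat \<Rightarrow> 'a) \<Rightarrow> nat set \<Rightarrow> 'a set \<Rightarrow> bool" where
  "mislabels_all T \<omega> J H \<longleftrightarrow> (\<forall>i\<in>J. (\<omega> i \<in> H) \<noteq> (\<omega> i \<in> T))"

definition concept_error :: "'a measure \<Rightarrow> 'a set \<Rightarrow> 'a set \<Rightarrow> real" where
  "concept_error M T H = measure M {x \<in> space M. (x \<in> H) \<noteq> (x \<in> T)}"

definition learning_algorithm ::
    "'a measure \<Rightarrow> nat \<Rightarrow> (nat \<Rightarrow> ('a \<times> bool) list \<Rightarrow> 'a set) \<Rightarrow> bool" where
  "learning_algorithm M m0 A \<longleftrightarrow> (\<forall>m\<ge>m0. A m \<in> labeled_lists M m \<rightarrow> sets M)"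

text \<open>
  The event whose probability is bounded. As \<^const>\<open>measure\<close> is 0 outside the \<open>\<sigma>\<close>-algebra,
  \<open>PAC_T\<close> is meaningful only for algorithms for which this event is measurable.
\<close>

definition error_event ::
    "'a measure \<Rightarrow> 'a set \<Rightarrow> (nat \<Rightarrow> ('a \<times> bool) list \<Rightarrow> 'a set) \<Rightarrow> nat \<Rightarrow> real \<Rightarrow> (nat \<Rightarrow> 'a) set" where
  "error_event M T A m \<epsilon> =
     {\<omega> \<in> space (multisamples M m). concept_error M T (A m (labeled T \<omega> {1..m})) > \<epsilon>}"

definition PAC_T ::
    "'a measure \<Rightarrow> 'a set \<Rightarrow> nat \<Rightarrow> (nat \<Rightarrow> ('a \<times> bool) list \<Rightarrow> 'a set) \<Rightarrow> (nat \<Rightarrow> real \<Rightarrow> real) \<Rightarrow> bool"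
  where
  "PAC_T M T m0 A q \<longleftrightarrow>
     (\<forall>\<epsilon>\<in>{0<..<1}. \<forall>m\<ge>m0. measure (multisamples M m) (error_event M T A m \<epsilon>) \<le> q m \<epsilon>) \<and>
     (\<forall>\<epsilon>\<in>{0<..<1}. (\<lambda>m. q m \<epsilon>) \<longlonglongrightarrow> 0)"

end

theory Submission
  imports Defs "HOL-Real_Asymp.Real_Asymp"
begin

text \<open>
  Let \<open>V\<close> be the error of the hypothesis built from \<open>d\<close> samples. Given these samples, the others are
  mislabeled independently with probability \<open>V\<close>. Hence uniqueness of the consistent index set among
  \<open>k + d\<close> samples, summed over all candidates, reads \<open>((k + d) choose d) E(1 - V)\<^sup>k = 1\<close>. These moments
  determine the law of \<open>V\<close>, which is the Beta(d,1) law with density \<open>d v\<^sup>d\<^sup>-\<^sup>1\<close>. The union bound over the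
  disjoint pairs of a \<open>d\<close>-set of defining samples and an \<open>r\<close>-set of mislabeled ones bounds the error
  probability by \<open>(m choose d) ((m - d) choose r)\<close> times the expectation of \<open>V\<^sup>r (1 - V)\<^sup>m\<^sup>-\<^sup>d\<^sup>-\<^sup>r\<close> on
  \<open>V \<ge> \<epsilon>\<close>, an incomplete Beta integral which equals the stated binomial tail because the derivative
  of a binomial distribution function in its parameter telescopes to a single term.
\<close>

section \<open>Binomial tails\<close>

definition binomial_cdf :: "nat \<Rightarrow> nat \<Rightarrow> real \<Rightarrow> real" where
  "binomial_cdf n l x = (\<Sum>i\<le>l. real (n choose i) * x ^ i * (1 - x) ^ (n - i))"

text \<open>Induction on \<open>l\<close>: the rising part of the derivative of the new summand
  cancels the single term left so far, by the absorption identity, and its falling part becomes the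
  new remainder.\<close>

lemma binomial_cdf_has_derivative:
  assumes "l < n"
  shows "(binomial_cdf n l has_real_derivative
            - (real (n - l) * real (n choose l) * x ^ l * (1 - x) ^ (n - l - 1))) (at x)"
  using assms
proof (induction l)
  case 0
  show ?case
    unfolding binomial_cdf_def by (auto intro!: derivative_eq_intros)
next
  case (Suc l)
  \<comment> \<open>Writing \<open>n\<close> as a sum lets the simplifier evaluate the truncated
    subtractions in the exponents.\<close>
  define k where "k = n - l - 2"
  have n: "n = k + l + 2" using Suc.prems by (simp add: k_def)
  have absorb: "real (Suc l) * real (n choose Suc l) = real (n - l) * real (n choose l)"
    unfolding of_nat_mult[symmetric]
    by (metis Suc_times_binomial binomial_absorb_comp binomial_absorption mult.commute of_nat_eq_iff)
  have "((\<lambda>x. binomial_cdf n l x + real (n choose Suc l) * x ^ Suc l * (1 - x) ^ (n - Suc l))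
      has_real_derivative
      - (real (n - l) * real (n choose l) * x ^ l * (1 - x) ^ (n - l - 1))
      + real (n choose Suc l) * (real (Suc l) * x ^ l * (1 - x) ^ (n - l - 1)
      - real (n - Suc l) * x ^ Suc l * (1 - x) ^ (n - Suc l - 1))) (at x)"
    using Suc.prems
    by (intro DERIV_add Suc.IH)
      (auto intro!: derivative_eq_intros simp: algebra_simps n simp del: power_Suc)
  moreover have "- (real (n - l) * real (n choose l) * x ^ l * (1 - x) ^ (n - l - 1))
      + real (n choose Suc l) * (real (Suc l) * x ^ l * (1 - x) ^ (n - l - 1)
      - real (n - Suc l) * x ^ Suc l * (1 - x) ^ (n - Suc l - 1)) =
      - (real (n - Suc l) * real (n choose Suc l) * x ^ Suc l * (1 - x) ^ (n - Suc l - 1))"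
    unfolding absorb[symmetric] by (simp add: algebra_simps del: of_nat_Suc power_Suc)
  moreover have "binomial_cdf n (Suc l) =
      (\<lambda>x. binomial_cdf n l x + real (n choose Suc l) * x ^ Suc l * (1 - x) ^ (n - Suc l))"
    by (simp add: binomial_cdf_def fun_eq_iff)
  ultimately show ?case by metis
qed

lemma binomial_cdf_0: "binomial_cdf n l 0 = 1"
  by (induction l) (auto simp: binomial_cdf_def)

lemma binomial_cdf_1: "l < n \<Longrightarrow> binomial_cdf n l 1 = 0"
  by (auto simp: binomial_cdf_def power_0_left intro!: sum.neutral)

text \<open>Exchanging successes and failures, \<open>i\<close> to \<open>n - i\<close>, turns the
  lower tail at \<open>1 - x\<close> into the upper tail at \<open>x\<close>, whose complement stops
  at \<open>k - 1\<close>. This translates from the variable \<open>1 - V\<close> back to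
  \<open>V\<close>.\<close>

lemma binomial_cdf_reflect:
  assumes "0 < k" "k \<le> n"
  shows "1 - binomial_cdf n (n - k) (1 - x) = (\<Sum>i=0..k-1. real (n choose i) * x ^ i * (1 - x) ^ (n - i))"
proof -
  let ?f = "\<lambda>i. real (n choose i) * x ^ i * (1 - x) ^ (n - i)"
  have "binomial_cdf n (n - k) (1 - x) = (\<Sum>i=k..n. ?f i)"
    unfolding binomial_cdf_def
    by (rule sum.reindex_bij_witness[of _ "\<lambda>i. n - i" "\<lambda>i. n - i"])
      (use assms in \<open>auto simp: binomial_symmetric[symmetric]\<close>)
  moreover have "(\<Sum>i=0..k-1. ?f i) + (\<Sum>i=k..n. ?f i) = (\<Sum>i=0..n. ?f i)"
    using assms sum.ub_add_nat[of 0 "k - 1" ?f "n - (k - 1)"] by simp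
  moreover have "(\<Sum>i=0..n. ?f i) = 1"
    using binomial_ring[of x "1 - x" n] by (simp add: atLeast0AtMost)
  ultimately show ?thesis by simp
qed

text \<open>The number of summands is fixed, and each is eventually at most a power of
  \<open>m\<close> times a multiple of \<open>(1 - \<epsilon>) ^ m\<close>.\<close>

lemma binomial_lower_tail_tendsto_0:
  fixes \<epsilon> :: real
  assumes "0 < \<epsilon>" "\<epsilon> < 1"
  shows "(\<lambda>m. \<Sum>i=0..k. real (m choose i) * \<epsilon> ^ i * (1 - \<epsilon>) ^ (m - i)) \<longlonglongrightarrow> 0"
proof (rule tendsto_null_sum)
  fix i
  have lim: "(\<lambda>m. (real m ^ i * (1 - \<epsilon>) ^ m) * (\<epsilon> ^ i / (1 - \<epsilon>) ^ i)) \<longlonglongrightarrow> 0"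
    by (intro tendsto_mult_left_zero) (use assms in real_asymp)
  show "(\<lambda>m. real (m choose i) * \<epsilon> ^ i * (1 - \<epsilon>) ^ (m - i)) \<longlonglongrightarrow> 0"
  proof (rule tendsto_sandwich[OF _ _ tendsto_const lim])
    show "\<forall>\<^sub>F m in sequentially. real (m choose i) * \<epsilon> ^ i * (1 - \<epsilon>) ^ (m - i)
        \<le> (real m ^ i * (1 - \<epsilon>) ^ m) * (\<epsilon> ^ i / (1 - \<epsilon>) ^ i)"
      using eventually_ge_at_top[of i]
    proof eventually_elim
      case (elim m)
      have "real (m choose i) \<le> real m ^ i"
        using binomial_le_pow[OF elim] by (metis of_nat_le_iff of_nat_power)
      then have "real (m choose i) * (\<epsilon> ^ i * (1 - \<epsilon>) ^ (m - i)) \<le> real m ^ i * (\<epsilon> ^ i * (1 - \<epsilon>) ^ (m - i))"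
        using assms by (intro mult_right_mono) auto
      then show ?case
        using assms elim by (simp add: power_diff field_simps)
    qed
  qed (use assms in auto)
qed

section \<open>The Beta law and its moments\<close>

text \<open>The law of \<open>1 - V\<close>, where \<open>V\<close> has the Beta(d,1) density \<open>d v\<^sup>d\<^sup>-\<^sup>1\<close> on the unit interval.\<close>

definition beta_law :: "nat \<Rightarrow> real measure" where
  "beta_law d = density lborel (\<lambda>w. ennreal (real d * (1 - w) ^ (d - 1) * indicator {0..1} w))"

text \<open>On \<open>{0..c}\<close> the integrand times the density is a constant multiple of the
  derivative of \<open>binomial_cdf (l + j + d) l\<close>, so the fundamental theorem of calculus
  applies. The moments use \<open>c = 1\<close> and \<open>j = 0\<close>, the error tail
  \<open>c = 1 - \<epsilon>\<close> and \<open>j = r\<close>.\<close>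

lemma beta_law_integral:
  assumes "0 < d" "0 \<le> c" "c \<le> 1"
  shows "(\<integral>w. w ^ l * (1 - w) ^ j * indicator {0..c} w \<partial>beta_law d) =
    real d * (1 - binomial_cdf (l + j + d) l c) / (real (j + d) * real ((l + j + d) choose l))"
proof -
  define n where "n = l + j + d"
  \<comment> \<open>\<open>K\<close> cancels the factor \<open>(n - l) * (n choose l)\<close> of the
    derivative, where \<open>n - l = j + d\<close>, and leaves the factor \<open>d\<close> of the
    density.\<close>
  define K where "K = real d / (real (j + d) * real (n choose l))"
  have pos: "0 < real (j + d) * real (n choose l)"
    using assms by (simp add: n_def)
  have "(\<integral>w. w ^ l * (1 - w) ^ j * indicator {0..c} w \<partial>beta_law d) =
      (\<integral>w. (real d * (1 - w) ^ (d - 1) * indicator {0..1} w) *\<^sub>R (w ^ l * (1 - w) ^ j * indicator {0..c} w) \<partial>lborel)"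
    unfolding beta_law_def
    by (rule integral_density) (auto split: split_indicator)
  also have "\<dots> = (\<integral>w. (real d * w ^ l * (1 - w) ^ (j + d - 1)) * indicator {0..c} w \<partial>lborel)"
    using assms by (intro Bochner_Integration.integral_cong) (auto split: split_indicator simp: add.commute simp flip: power_add)
  also have "\<dots> = - K * binomial_cdf n l c - (- K * binomial_cdf n l 0)"
  proof (rule integral_FTC_Icc_real)
    fix x :: real
    have "((\<lambda>x. - K * binomial_cdf n l x) has_real_derivative
      - K * - (real (n - l) * real (n choose l) * x ^ l * (1 - x) ^ (n - l - 1))) (at x)"
      using assms by (intro DERIV_cmult binomial_cdf_has_derivative) (simp add: n_def)
    moreover have "n - l = j + d" by (simp add: n_def)
    moreover have "- K * - (real (j + d) * real (n choose l) * u * v) = real d * u * v" for u v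
    proof -
      have "- K * - (a * b * u * v) = (K * (a * b)) * u * v" for a b
        by simp
      also have "K * (real (j + d) * real (n choose l)) = real d"
        by (metis K_def nonzero_eq_divide_eq order_less_irrefl pos)
      finally show ?thesis .
    qed
    ultimately show "((\<lambda>x. - K * binomial_cdf n l x) has_real_derivative
      real d * x ^ l * (1 - x) ^ (j + d - 1)) (at x)"
      by (simp only:)
  qed (use assms in \<open>auto intro!: continuous_intros\<close>)
  also have "\<dots> = K * (1 - binomial_cdf n l c)"
    by (simp add: binomial_cdf_0 right_diff_distrib)
  finally show ?thesis
    by (simp add: K_def n_def)
qed

lemma beta_law_supported: "AE w in beta_law d. w \<in> {0..1}"
  unfolding beta_law_def by (subst AE_density) (auto split: split_indicator)

lemma beta_law_moment:
  assumes "0 < d"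
  shows "(\<integral>w. w ^ k \<partial>beta_law d) = 1 / real ((k + d) choose d)"
proof -
  have "(\<integral>w. w ^ k \<partial>beta_law d) = (\<integral>w. w ^ k * (1 - w) ^ 0 * indicator {0..1} w \<partial>beta_law d)"
    using beta_law_supported[of d]
    by (intro integral_cong_AE) (auto simp: beta_law_def split: split_indicator)
  also have "\<dots> = 1 / real ((k + d) choose k)"
    using assms by (subst beta_law_integral) (auto simp: binomial_cdf_1)
  also have "(k + d) choose k = (k + d) choose d"
    using binomial_symmetric[of k "k + d"] by simp
  finally show ?thesis .
qed

lemma real_distribution_beta_law:
  assumes "0 < d"
  shows "real_distribution (beta_law d)"
proof -
  \<comment> \<open>The density is bounded by \<open>d\<close> on the unit interval. With finiteness
    known, the zeroth moment, which is the real-valued total mass, determines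
    \<open>emeasure\<close>.\<close>
  interpret beta: finite_measure "beta_law d"
  proof
    have "emeasure (beta_law d) (space (beta_law d)) = (\<integral>\<^sup>+ w. ennreal (real d * (1 - w) ^ (d - 1) * indicator {0..1} w) \<partial>lborel)"
      unfolding beta_law_def by (subst emeasure_density) auto
    also have "\<dots> \<le> (\<integral>\<^sup>+ w. ennreal (real d) * indicator {0..1::real} w \<partial>lborel)"
      by (rule nn_integral_mono)
        (auto split: split_indicator intro!: ennreal_leI mult_left_le power_le_one simp flip: ennreal_indicator ennreal_mult')
    also have "\<dots> = ennreal (real d)"
      by (subst nn_integral_cmult_indicator) auto
    finally show "emeasure (beta_law d) (space (beta_law d)) \<noteq> \<infinity>"
      by (auto simp: top_unique)
  qed
  have "measure (beta_law d) (space (beta_law d)) = 1"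
    using beta_law_moment[OF assms, of 0] by simp
  then have "prob_space (beta_law d)"
    by (intro prob_spaceI) (simp add: beta.emeasure_eq_measure)
  then show ?thesis
    by (intro real_distribution.intro real_distribution_axioms.intro) (auto simp: beta_law_def)
qed

text \<open>On the unit interval all moments are at most 1, so the Taylor remainder of the
  characteristic function is at most \<open>2 * \<bar>t\<bar> ^ n / fact n\<close> and tends to 0
  for every \<open>t\<close>. The moments thus determine the characteristic function, and with it
  the law.\<close>

lemma real_distribution_moments_unit_eqI:
  assumes "real_distribution M1" "real_distribution M2"
    and "AE x in M1. x \<in> {0..1}" "AE x in M2. x \<in> {0..1}"
    and moments: "\<And>k. (\<integral>x. x ^ k \<partial>M1) = (\<integral>x. x ^ k \<partial>M2)"
  shows "M1 = M2"
proof (rule Levy_uniqueness[OF assms(1,2)], rule ext)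
  fix t :: real
  \<comment> \<open>Taylor polynomials of the characteristic function of \<open>M1\<close>; equality
    of the moments makes them those of \<open>M2\<close> as well, so both values are limits of one
    sequence.\<close>
  define s where "s n = (\<Sum>k\<le>n. ((\<i> * t) ^ k / fact k) * (\<integral>x. x ^ k \<partial>M1))" for n
  have "s \<longlonglongrightarrow> char N t"
    if N: "real_distribution N" "AE x in N. x \<in> {0..1}" "\<And>k. (\<integral>x. x ^ k \<partial>N) = (\<integral>x. x ^ k \<partial>M1)" for N
  proof -
    interpret real_distribution N by fact
    have bound: "AE x in N. norm (x ^ k) \<le> 1" for k
      using N(2) by eventually_elim (auto simp: norm_power intro!: power_le_one)
    have int: "integrable N (\<lambda>x. x ^ k)" for k
      by (rule integrable_const_bound[OF bound]) auto
    have "cmod (char N t - s n) \<le> 2 * (\<bar>t\<bar> ^ n / fact n)" for n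
    proof -
      have "expectation (\<lambda>x. \<bar>x\<bar> ^ n) \<le> 1"
        using integrable_abs[OF int, of n] bound[of n]
        by (intro integral_le_const) (auto simp: power_abs)
      then have "(2 * \<bar>t\<bar> ^ n / fact n) * expectation (\<lambda>x. \<bar>x\<bar> ^ n) \<le> (2 * \<bar>t\<bar> ^ n / fact n) * 1"
        by (intro mult_left_mono) auto
      then show ?thesis
        using char_approx1[of n t, OF int] by (simp add: s_def N(3))
    qed
    moreover have "(\<lambda>n. 2 * (\<bar>t\<bar> ^ n / fact n)) \<longlonglongrightarrow> 2 * 0"
      using summable_LIMSEQ_zero[OF summable_exp[of "\<bar>t\<bar>"]]
      by (intro tendsto_mult tendsto_const) (simp add: field_simps)
    ultimately have "(\<lambda>n. char N t - s n) \<longlonglongrightarrow> 0"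
      by (intro Lim_null_comparison[of "\<lambda>n. char N t - s n" "\<lambda>n. 2 * (\<bar>t\<bar> ^ n / fact n)"]
          always_eventually)
        (auto simp only: mult_zero_right)
    from tendsto_diff[OF tendsto_const[of "char N t"] this] show ?thesis
      by simp
  qed
  from this[of M1] this[of M2] show "char M1 t = char M2 t"
    using assms by (intro LIMSEQ_unique[of s]) auto
qed

section \<open>Mislabeling patterns of independent samples\<close>

text \<open>Renumbering the chosen samples makes their law depend on \<open>J\<close> only through its cardinality.\<close>

definition pick :: "nat set \<Rightarrow> (nat \<Rightarrow> 'a) \<Rightarrow> nat \<Rightarrow> 'a" where
  "pick J \<omega> = (\<lambda>i\<in>{..<card J}. \<omega> (sorted_list_of_set J ! i))"

text \<open>Through this identity a hypothesis built from the samples in \<open>J\<close> becomes a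
  function of \<open>pick J \<omega>\<close> alone.\<close>

lemma labeled_eq_pick:
  "labeled T \<omega> J = map (\<lambda>i. (pick J \<omega> i, pick J \<omega> i \<in> T)) [0..<card J]"
  by (rule nth_equalityI) (auto simp: labeled_def pick_def)

lemma sorted_list_of_set_nth_in: "finite J \<Longrightarrow> i < card J \<Longrightarrow> sorted_list_of_set J ! i \<in> J"
  using nth_mem[of i "sorted_list_of_set J"] by simp

lemma inj_on_sorted_list_of_set_nth: "inj_on (\<lambda>i. sorted_list_of_set J ! i) {..<card J}"
  by (auto simp: inj_on_def nth_eq_iff_index_eq)

lemma pick_cong:
  assumes "finite J" "\<And>j. j \<in> J \<Longrightarrow> \<omega> j = \<omega>' j"
  shows "pick J \<omega> = pick J \<omega>'"
  using assms sorted_list_of_set_nth_in by (auto simp: pick_def restrict_def fun_eq_iff)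

lemma measurable_pick [measurable (raw)]:
  assumes "finite I" "J \<subseteq> I"
  shows "pick J \<in> PiM I (\<lambda>_. M) \<rightarrow>\<^sub>M PiM {..<card J} (\<lambda>_. M)"
proof -
  have "finite J" using assms finite_subset by blast
  then show ?thesis
    unfolding pick_def using assms sorted_list_of_set_nth_in
    by (intro measurable_restrict measurable_component_singleton) blast
qed

lemma (in prob_space) distr_pick:
  assumes "finite J"
  shows "distr (PiM J (\<lambda>_. M)) (PiM {..<card J} (\<lambda>_. M)) (pick J) = PiM {..<card J} (\<lambda>_. M)"
  unfolding pick_def
  using assms sorted_list_of_set_nth_in inj_on_sorted_list_of_set_nth prob_space_axioms
  by (intro distr_PiM_reindex[of _ "\<lambda>_. M"]) auto

text \<open>\<open>S x\<close> plays the role of the points mislabeled by the hypothesis built from the \<open>d\<close> samples \<open>x\<close>.\<close>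

locale random_set = prob_space +
  fixes d :: nat and S :: "(nat \<Rightarrow> 'a) \<Rightarrow> 'a set"
  assumes S_space: "\<And>x. x \<in> space (PiM {..<d} (\<lambda>_. M)) \<Longrightarrow> S x \<subseteq> space M"
    and S_sets: "{z \<in> space (PiM {..<d} (\<lambda>_. M) \<Otimes>\<^sub>M M). snd z \<in> S (fst z)}
                   \<in> sets (PiM {..<d} (\<lambda>_. M) \<Otimes>\<^sub>M M)"
begin

abbreviation samples :: "(nat \<Rightarrow> 'a) measure" where
  "samples \<equiv> PiM {..<d} (\<lambda>_. M)"

definition S_prob :: "(nat \<Rightarrow> 'a) \<Rightarrow> real" where
  "S_prob x = prob (S x)"

lemma S_prob_measurable [measurable]: "S_prob \<in> borel_measurable samples"
proof -
  have "(\<lambda>x. enn2real (emeasure M (S x))) \<in> borel_measurable samples"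
    using measurable_emeasure[OF S_space S_sets] by measurable
  then show ?thesis
    unfolding S_prob_def[abs_def] measure_def .
qed

lemma S_prob_bounds: "0 \<le> S_prob x" "S_prob x \<le> 1"
  by (auto simp: S_prob_def)

lemma S_in_sets: "x \<in> space samples \<Longrightarrow> S x \<in> sets M"
proof -
  assume x: "x \<in> space samples"
  have "Pair x -` {z \<in> space (samples \<Otimes>\<^sub>M M). snd z \<in> S (fst z)} = S x"
    using x S_space[OF x] by (auto simp: space_pair_measure)
  then show ?thesis using sets_Pair1[OF S_sets, of x] by simp
qed

lemma pick_space: "finite I \<Longrightarrow> J \<subseteq> I \<Longrightarrow> card J = d \<Longrightarrow> \<omega> \<in> space (PiM I (\<lambda>_. M)) \<Longrightarrow> pick J \<omega> \<in> space samples"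
  using measurable_space[OF measurable_pick[of I J M]] by simp

text \<open>Used twice: with \<open>K2 = {}\<close> and \<open>B = UNIV\<close> for consistency of a
  candidate in the moment identity, and with \<open>B = {\<epsilon>..}\<close> for the events of the
  union bound.\<close>

definition pattern_event :: "nat set \<Rightarrow> nat set \<Rightarrow> nat set \<Rightarrow> nat set \<Rightarrow> real set \<Rightarrow> (nat \<Rightarrow> 'a) set" where
  "pattern_event I J K1 K2 B = {\<omega> \<in> space (PiM I (\<lambda>_. M)).
     (\<forall>k\<in>K1. \<omega> k \<notin> S (pick J \<omega>)) \<and> (\<forall>k\<in>K2. \<omega> k \<in> S (pick J \<omega>)) \<and> S_prob (pick J \<omega>) \<in> B}"

lemma pattern_event_sets:
  assumes "finite I" "J \<subseteq> I" "card J = d" "K1 \<subseteq> I" "K2 \<subseteq> I" "B \<in> sets borel"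
  shows "pattern_event I J K1 K2 B \<in> sets (PiM I (\<lambda>_. M))"
proof -
  let ?N = "PiM I (\<lambda>_. M)"
  have pick: "pick J \<in> ?N \<rightarrow>\<^sub>M samples"
    using measurable_pick[OF assms(1,2), of M] assms(3) by simp
  have mem: "{\<omega> \<in> space ?N. \<omega> k \<in> S (pick J \<omega>)} \<in> sets ?N" if "k \<in> I" for k
  proof -
    \<comment> \<open>Both the set and the tested point are random, so the event is pulled back from
      the pair space, where \<open>S_sets\<close> provides joint measurability.\<close>
    have "(\<lambda>\<omega>. (pick J \<omega>, \<omega> k)) \<in> ?N \<rightarrow>\<^sub>M samples \<Otimes>\<^sub>M M"
      using that pick by measurable
    from measurable_sets[OF this S_sets]
    have "(\<lambda>\<omega>. (pick J \<omega>, \<omega> k)) -` {z \<in> space (samples \<Otimes>\<^sub>M M). snd z \<in> S (fst z)} \<inter> space ?N \<in> sets ?N" .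
    also have "(\<lambda>\<omega>. (pick J \<omega>, \<omega> k)) -` {z \<in> space (samples \<Otimes>\<^sub>M M). snd z \<in> S (fst z)} \<inter> space ?N
        = {\<omega> \<in> space ?N. \<omega> k \<in> S (pick J \<omega>)}"
      using measurable_space[OF \<open>(\<lambda>\<omega>. (pick J \<omega>, \<omega> k)) \<in> ?N \<rightarrow>\<^sub>M samples \<Otimes>\<^sub>M M\<close>] by auto
    finally show ?thesis .
  qed
  have fin: "finite K1" "finite K2" using assms finite_subset by blast+
  have "{\<omega> \<in> space ?N. S_prob (pick J \<omega>) \<in> B} \<in> sets ?N"
    using pick assms(6) by measurable
  then show ?thesis
    unfolding pattern_event_def
    using mem fin assms(4,5)
    by (intro sets.sets_Collect_conj sets.sets_Collect_finite_All sets.sets_Collect_neg) auto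
qed

text \<open>Fubini with the samples in \<open>J\<close> held fixed: then \<open>S\<close> is a fixed
  set, and the samples outside \<open>J\<close> fall into it independently, each with probability
  \<open>S_prob\<close>. Every sample of \<open>K1\<close> contributes a factor
  \<open>1 - S_prob\<close> and every sample of \<open>K2\<close> a factor
  \<open>S_prob\<close>.\<close>

lemma emeasure_pattern_event:
  assumes "finite I" "J \<subseteq> I" "card J = d" "K1 \<subseteq> I - J" "K2 \<subseteq> I - J" "K1 \<inter> K2 = {}" "B \<in> sets borel"
  shows "emeasure (PiM I (\<lambda>_. M)) (pattern_event I J K1 K2 B) =
    (\<integral>\<^sup>+x. ennreal ((1 - S_prob x) ^ card K1 * S_prob x ^ card K2 * indicator B (S_prob x)) \<partial>samples)"
proof -
  interpret P: product_sigma_finite "\<lambda>_::nat. M"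
    by (intro product_sigma_finite.intro sigma_finite_measure_axioms)
  let ?K = "I - J" and ?E = "pattern_event I J K1 K2 B"
  let ?g = "\<lambda>x. ennreal ((1 - S_prob x) ^ card K1 * S_prob x ^ card K2 * indicator B (S_prob x))"
  have I: "J \<union> ?K = I" "finite J" "finite ?K"
    using assms finite_subset by blast+
  have fin: "finite K1" "finite K2" using assms finite_subset by blast+
  have E: "?E \<in> sets (PiM (J \<union> ?K) (\<lambda>_. M))"
    using pattern_event_sets[of I J K1 K2 B] assms I by auto
  have slice: "emeasure (PiM ?K (\<lambda>_. M)) ((\<lambda>y. merge J ?K (x, y)) -` ?E \<inter> space (PiM ?K (\<lambda>_. M)))
      = ?g (pick J x)" if x: "x \<in> space (PiM J (\<lambda>_. M))" for x
  proof -
    let ?p = "pick J x"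
    have p: "?p \<in> space samples"
      using pick_space[of J J x] I assms x by simp
    have pm: "pick J (merge J ?K (x, y)) = ?p" for y
      by (rule pick_cong) (use I in auto)
    have merge: "merge J ?K (x, y) \<in> space (PiM I (\<lambda>_. M))" if "y \<in> space (PiM ?K (\<lambda>_. M))" for y
      using measurable_space[OF measurable_merge[of J ?K "\<lambda>_. M"], of "(x, y)"] that x I(1)
      by (simp add: space_pair_measure)
    \<comment> \<open>The slice over fixed \<open>x\<close> is a box with sides \<open>Q k\<close>;
      unconstrained coordinates get the whole space and contribute the factor 1.\<close>
    define Q where "Q k = (if k \<in> K1 then space M - S ?p else if k \<in> K2 then S ?p else space M)" for k
    have Q: "Q k \<in> sets M" for k
      using S_in_sets[OF p] by (auto simp: Q_def)
    show ?thesis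
    proof (cases "S_prob ?p \<in> B")
      case False
      then have "(\<lambda>y. merge J ?K (x, y)) -` ?E \<inter> space (PiM ?K (\<lambda>_. M)) = {}"
        by (auto simp: pattern_event_def pm)
      with False show ?thesis by simp
    next
      case True
      have "(\<lambda>y. merge J ?K (x, y)) -` ?E \<inter> space (PiM ?K (\<lambda>_. M)) = Pi\<^sub>E ?K Q"
      proof (intro set_eqI iffI)
        fix y assume y: "y \<in> (\<lambda>y. merge J ?K (x, y)) -` ?E \<inter> space (PiM ?K (\<lambda>_. M))"
        then show "y \<in> Pi\<^sub>E ?K Q"
          using assms by (auto simp: pattern_event_def pm Q_def space_PiM PiE_iff)
      next
        fix y assume y: "y \<in> Pi\<^sub>E ?K Q"
        then have ys: "y \<in> space (PiM ?K (\<lambda>_. M))"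
          using Q[THEN sets.sets_into_space] by (auto simp: space_PiM PiE_iff)
        have yQ: "y k \<in> Q k" if "k \<in> I" "k \<notin> J" for k
          using y that by auto
        have "y k \<notin> S ?p" "k \<notin> J" "k \<in> I" if "k \<in> K1" for k
          using yQ[of k] that assms by (auto simp: Q_def)
        moreover have "y k \<in> S ?p" "k \<notin> J" "k \<in> I" if "k \<in> K2" for k
        proof -
          show "k \<notin> J" "k \<in> I" using that assms by auto
          moreover have "k \<notin> K1" using that assms by auto
          ultimately show "y k \<in> S ?p" using yQ[of k] that by (auto simp: Q_def)
        qed
        ultimately show "y \<in> (\<lambda>y. merge J ?K (x, y)) -` ?E \<inter> space (PiM ?K (\<lambda>_. M))"
          using ys True merge[OF ys] by (auto simp: pattern_event_def pm)
      qed
      then have "emeasure (PiM ?K (\<lambda>_. M)) ((\<lambda>y. merge J ?K (x, y)) -` ?E \<inter> space (PiM ?K (\<lambda>_. M)))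
          = (\<Prod>k\<in>?K. emeasure M (Q k))"
        using P.emeasure_PiM[OF I(3), of Q] Q by simp
      also have "\<dots> = (\<Prod>k\<in>?K. ennreal (prob (Q k)))"
        by (simp add: emeasure_eq_measure)
      also have "\<dots> = ennreal (\<Prod>k\<in>?K. prob (Q k))"
        by (simp add: prod_ennreal)
      also have "(\<Prod>k\<in>?K. prob (Q k)) = (\<Prod>k\<in>K1 \<union> K2. prob (Q k))"
        using assms I by (intro prod.mono_neutral_right) (auto simp: Q_def prob_space)
      also have "\<dots> = (\<Prod>k\<in>K1. prob (Q k)) * (\<Prod>k\<in>K2. prob (Q k))"
        using assms fin by (intro prod.union_disjoint)
      also have "(\<Prod>k\<in>K1. prob (Q k)) = (1 - S_prob ?p) ^ card K1"
        using S_in_sets[OF p] by (simp add: Q_def prob_compl S_prob_def)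
      also have "(\<Prod>k\<in>K2. prob (Q k)) = (\<Prod>k\<in>K2. S_prob ?p)"
        using assms by (intro prod.cong) (auto simp: Q_def S_prob_def)
      finally show ?thesis using True by simp
    qed
  qed
  have "emeasure (PiM I (\<lambda>_. M)) ?E = (\<integral>\<^sup>+x. ?g (pick J x) \<partial>PiM J (\<lambda>_. M))"
    using P.emeasure_fold_integral[OF _ I(2,3) E] I(1) slice
    by (simp add: cong: nn_integral_cong)
  also have "\<dots> = (\<integral>\<^sup>+x. ?g x \<partial>distr (PiM J (\<lambda>_. M)) samples (pick J))"
    using measurable_pick[OF I(2), of J M] assms(3,7)
    by (intro nn_integral_distr[symmetric]) auto
  also have "distr (PiM J (\<lambda>_. M)) samples (pick J) = samples"
    using distr_pick[OF I(2)] assms(3) by simp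
  finally show ?thesis .
qed

lemma measure_pattern_event:
  assumes "finite I" "J \<subseteq> I" "card J = d" "K1 \<subseteq> I - J" "K2 \<subseteq> I - J" "K1 \<inter> K2 = {}" "B \<in> sets borel"
  shows "measure (PiM I (\<lambda>_. M)) (pattern_event I J K1 K2 B) =
    (\<integral>x. (1 - S_prob x) ^ card K1 * S_prob x ^ card K2 * indicator B (S_prob x) \<partial>samples)"
proof -
  have "(\<integral>x. (1 - S_prob x) ^ card K1 * S_prob x ^ card K2 * indicator B (S_prob x) \<partial>samples)
      = enn2real (\<integral>\<^sup>+x. ennreal ((1 - S_prob x) ^ card K1 * S_prob x ^ card K2 * indicator B (S_prob x)) \<partial>samples)"
    using S_prob_bounds assms(7) by (intro integral_eq_nn_integral) auto
  then show ?thesis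
    using emeasure_pattern_event[OF assms] by (simp add: measure_def)
qed

end

section \<open>The law of the error\<close>

context random_set
begin

text \<open>The hypothesis says that the \<open>k\<close>-th moment of \<open>1 - S_prob\<close> is
  the reciprocal of \<open>(k + d) choose d\<close>, which is the \<open>k\<close>-th moment of
  \<open>beta_law d\<close>.\<close>

lemma distr_S_prob:
  assumes "0 < d"
    and moments: "\<And>k. real ((k + d) choose d) * (\<integral>x. (1 - S_prob x) ^ k \<partial>samples) = 1"
  shows "distr samples borel (\<lambda>x. 1 - S_prob x) = beta_law d"
proof (rule real_distribution_moments_unit_eqI)
  interpret samples: prob_space samples
    by (intro prob_space_PiM prob_space_axioms)
  show "real_distribution (distr samples borel (\<lambda>x. 1 - S_prob x))"
    by (rule samples.real_distribution_distr) simp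
  show "real_distribution (beta_law d)"
    by (rule real_distribution_beta_law) fact
  show "AE w in beta_law d. w \<in> {0..1}"
    by (rule beta_law_supported)
  show "AE w in distr samples borel (\<lambda>x. 1 - S_prob x). w \<in> {0..1}"
    using S_prob_bounds by (subst AE_distr_iff) auto
  show "(\<integral>w. w ^ k \<partial>distr samples borel (\<lambda>x. 1 - S_prob x)) = (\<integral>w. w ^ k \<partial>beta_law d)" for k
  proof -
    have "(\<integral>w. w ^ k \<partial>distr samples borel (\<lambda>x. 1 - S_prob x)) = (\<integral>x. (1 - S_prob x) ^ k \<partial>samples)"
      by (rule integral_distr) auto
    also have "\<dots> = 1 / real ((k + d) choose d)"
      using moments[of k] by (auto simp: field_simps)
    finally show ?thesis
      using beta_law_moment[OF assms(1)] by simp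
  qed
qed

text \<open>The condition that \<open>S_prob\<close> is at least \<open>\<epsilon>\<close> confines
  \<open>1 - S_prob\<close> to \<open>{0..1 - \<epsilon>}\<close>, which gives an incomplete Beta
  integral.\<close>

lemma S_prob_tail_integral:
  assumes "0 < d" "0 < \<epsilon>" "\<epsilon> < 1"
    and law: "distr samples borel (\<lambda>x. 1 - S_prob x) = beta_law d"
  shows "(\<integral>x. (1 - S_prob x) ^ l * S_prob x ^ r * indicator {\<epsilon>..} (S_prob x) \<partial>samples) =
    real d * (1 - binomial_cdf (l + r + d) l (1 - \<epsilon>)) / (real (r + d) * real ((l + r + d) choose l))"
proof -
  let ?f = "\<lambda>w::real. w ^ l * (1 - w) ^ r * indicator {0..1 - \<epsilon>} w"
  have "(\<integral>x. (1 - S_prob x) ^ l * S_prob x ^ r * indicator {\<epsilon>..} (S_prob x) \<partial>samples)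
      = (\<integral>x. ?f (1 - S_prob x) \<partial>samples)"
    using S_prob_bounds by (intro Bochner_Integration.integral_cong) (auto split: split_indicator)
  also have "\<dots> = (\<integral>w. ?f w \<partial>distr samples borel (\<lambda>x. 1 - S_prob x))"
    by (rule integral_distr[symmetric]) auto
  also have "\<dots> = real d * (1 - binomial_cdf (l + r + d) l (1 - \<epsilon>)) / (real (r + d) * real ((l + r + d) choose l))"
    unfolding law using assms by (intro beta_law_integral) auto
  finally show ?thesis .
qed

end

text \<open>The left side counts the pairs of the union bound, times the numerator factor
  \<open>d\<close> of the tail integral; the right side exposes its denominator, which then
  cancels.\<close>

lemma choose_disjoint_pairs:
  assumes "0 < d" "d + r \<le> m"
  shows "real (m choose d) * real ((m - d) choose r) * real d
      = real ((r + d - 1) choose r) * (real (r + d) * real (m choose (m - d - r)))"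
proof -
  have "(m choose d) * ((m - d) choose r) = (m choose (d + r)) * ((d + r) choose d)"
    using choose_mult[of d "d + r" m] assms by simp
  moreover have "m choose (d + r) = m choose (m - d - r)"
    using binomial_symmetric[of "d + r" m] assms by simp
  moreover have "(d + r) choose d = (d + r) choose r"
    using binomial_symmetric[of r "d + r"] by simp
  moreover have "d * ((d + r) choose r) = (d + r) * ((d + r - 1) choose r)"
    using binomial_absorb_comp[of "d + r" r] by simp
  ultimately have "(m choose d) * ((m - d) choose r) * d
      = ((r + d - 1) choose r) * ((r + d) * (m choose (m - d - r)))"
    by (simp add: ac_simps)
  then show ?thesis
    by (metis of_nat_mult)
qed

section \<open>Consistent learners: moments of the error and the union bound\<close>

locale consistent_learner = prob_space M for M :: "'a measure" +
  fixes T :: "'a set" and r d :: nat and G :: "('a \<times> bool) list \<Rightarrow> 'a set"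
  assumes r_pos: "r > 0" and d_pos: "d > 0"
    and measurable_consistent:
      "\<And>m J K. m \<ge> d + r \<Longrightarrow> J \<in> [{1..m}]\<^bsup>d\<^esup> \<Longrightarrow> K \<subseteq> {1..m} \<Longrightarrow>
         {\<omega> \<in> space (multisamples M m). consistent T \<omega> K (G (labeled T \<omega> J))}
           \<in> sets (multisamples M m)"
    and consistent_own:
      "\<And>m \<omega> Ir Id. m \<ge> d + r \<Longrightarrow> \<omega> \<in> space (multisamples M m) \<Longrightarrow>
         Ir \<in> [{1..m}]\<^bsup>r\<^esup> \<Longrightarrow> Id \<in> [{1..m} - Ir]\<^bsup>d\<^esup> \<Longrightarrow>
         consistent T \<omega> Id (G (labeled T \<omega> Id))"
    and unique_consistent:
      "\<And>m. m \<ge> d + r \<Longrightarrow>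
         AE \<omega> in multisamples M m. \<forall>Ir \<in> [{1..m}]\<^bsup>r\<^esup>.
           \<exists>!Id. Id \<in> [{1..m} - Ir]\<^bsup>d\<^esup> \<and> consistent T \<omega> ({1..m} - Ir) (G (labeled T \<omega> Id))"
begin

text \<open>The argument is a numbered tuple, so that one function serves all index sets
  \<open>J\<close>: it is evaluated at \<open>pick J \<omega>\<close>. Its value is the part of the
  symmetric difference of target and hypothesis inside the domain.\<close>

definition mislabeled :: "(nat \<Rightarrow> 'a) \<Rightarrow> 'a set" where
  "mislabeled x = {y \<in> space M. (y \<in> G (map (\<lambda>i. (x i, x i \<in> T)) [0..<d])) \<noteq> (y \<in> T)}"

lemma mislabeled_pick:
  "card J = d \<Longrightarrow> mislabeled (pick J \<omega>) = {y \<in> space M. (y \<in> G (labeled T \<omega> J)) \<noteq> (y \<in> T)}"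
  by (simp add: mislabeled_def labeled_eq_pick)

lemma consistent_iff:
  assumes "\<omega> \<in> space (multisamples M m)" "card J = d" "K \<subseteq> {1..m}"
  shows "consistent T \<omega> K (G (labeled T \<omega> J)) \<longleftrightarrow> (\<forall>k\<in>K. \<omega> k \<notin> mislabeled (pick J \<omega>))"
proof -
  have "\<omega> k \<in> space M" if "k \<in> K" for k
    using that assms by (auto simp: space_PiM PiE_iff)
  then show ?thesis
    using assms(2) by (auto simp: consistent_def mislabeled_pick)
qed

lemma mislabels_all_iff:
  assumes "\<omega> \<in> space (multisamples M m)" "card J = d" "K \<subseteq> {1..m}"
  shows "mislabels_all T \<omega> K (G (labeled T \<omega> J)) \<longleftrightarrow> (\<forall>k\<in>K. \<omega> k \<in> mislabeled (pick J \<omega>))"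
proof -
  have "\<omega> k \<in> space M" if "k \<in> K" for k
    using that assms by (auto simp: space_PiM PiE_iff)
  then show ?thesis
    using assms(2) by (auto simp: mislabels_all_def mislabeled_pick)
qed

text \<open>Joint measurability in the tuple and the tested point comes from a single consistency
  event: the hypothesis built from samples \<open>1..d\<close> is tested on sample
  \<open>d + 1\<close>, an index that exists since \<open>r\<close> is positive.\<close>

lemma mislabeled_sets:
  "{z \<in> space (PiM {..<d} (\<lambda>_. M) \<Otimes>\<^sub>M M). snd z \<in> mislabeled (fst z)}
     \<in> sets (PiM {..<d} (\<lambda>_. M) \<Otimes>\<^sub>M M)"
proof -
  let ?P = "PiM {..<d} (\<lambda>_. M) \<Otimes>\<^sub>M M" and ?N = "multisamples M (d + r)"
  \<comment> \<open>\<open>F\<close> embeds a tuple numbered from 0 and a test point into a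
    multisample numbered from 1, repeating the test point at all indices above
    \<open>d\<close>.\<close>
  define F :: "(nat \<Rightarrow> 'a) \<times> 'a \<Rightarrow> nat \<Rightarrow> 'a"
    where "F z = (\<lambda>i\<in>{1..d + r}. if i \<le> d then fst z (i - 1) else snd z)" for z
  define C where "C = {\<omega> \<in> space ?N. consistent T \<omega> {d + 1} (G (labeled T \<omega> {1..d}))}"
  have C: "C \<in> sets ?N"
    unfolding C_def using r_pos by (intro measurable_consistent) (auto simp: nsets_def)
  have F: "F \<in> ?P \<rightarrow>\<^sub>M ?N"
    unfolding F_def
  proof (rule measurable_restrict)
    fix i assume "i \<in> {1..d + r}"
    then show "(\<lambda>z. if i \<le> d then fst z (i - 1) else snd z) \<in> ?P \<rightarrow>\<^sub>M M"
      by (cases "i \<le> d")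
        (auto intro!: measurable_compose[OF measurable_fst measurable_component_singleton])
  qed
  have "snd z \<in> mislabeled (fst z) \<longleftrightarrow> F z \<notin> C" if z: "z \<in> space ?P" for z
  proof -
    have Fz: "F z \<in> space ?N"
      using measurable_space[OF F z] .
    have list: "sorted_list_of_set {1..d} = [1..<Suc d]"
      using sorted_list_of_set_range[of 1 "Suc d"] by (simp only: atLeastLessThanSuc_atLeastAtMost)
    have "fst z \<in> extensional {..<d}"
      using z by (auto simp: space_pair_measure space_PiM PiE_def)
    moreover have "pick {1..d} (F z) i = fst z i" if "i < d" for i
    proof -
      have "sorted_list_of_set {1..d} ! i = i + 1"
        unfolding list using that by (simp add: nth_upt del: upt_Suc)
      then show ?thesis
        using that by (simp add: pick_def F_def)
    qed
    moreover have "pick {1..d} (F z) \<in> extensional {..<d}"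
      by (simp add: pick_def)
    ultimately have pick: "pick {1..d} (F z) = fst z"
      by (metis extensionalityI lessThan_iff)
    have "consistent T (F z) {d + 1} (G (labeled T (F z) {1..d})) \<longleftrightarrow> F z (d + 1) \<notin> mislabeled (fst z)"
      using consistent_iff[OF Fz, of "{1..d}" "{d + 1}"] r_pos pick by simp
    then have "F z \<in> C \<longleftrightarrow> F z (d + 1) \<notin> mislabeled (fst z)"
      unfolding C_def using Fz by blast
    also have "F z (d + 1) = snd z"
      using r_pos by (simp add: F_def)
    finally show ?thesis by blast
  qed
  then have "{z \<in> space ?P. snd z \<in> mislabeled (fst z)} = F -` (space ?N - C) \<inter> space ?P"
    using measurable_space[OF F] by auto
  also have "\<dots> \<in> sets ?P"
    using C by (intro measurable_sets[OF F]) auto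
  finally show ?thesis .
qed

sublocale random_set M d mislabeled
  by (intro random_set.intro random_set_axioms.intro prob_space_axioms mislabeled_sets)
    (simp add: mislabeled_def subset_eq)

lemma concept_error_eq: "card J = d \<Longrightarrow> concept_error M T (G (labeled T \<omega> J)) = S_prob (pick J \<omega>)"
  by (simp add: concept_error_def S_prob_def mislabeled_pick)

text \<open>Almost surely exactly one of the \<open>(k + d) choose d\<close> candidates fits
  \<open>k + d\<close> samples, so their probabilities add up to 1. Each of them is the probability
  that the \<open>k\<close> samples outside the candidate are labeled correctly.\<close>

lemma survival_moment: "real ((k + d) choose d) * (\<integral>x. (1 - S_prob x) ^ k \<partial>samples) = 1"
proof -
  \<comment> \<open>The last \<open>r\<close> of the \<open>m\<close> samples form the removed set
    \<open>Ir\<close>, so that uniqueness at size \<open>m\<close> speaks about exactly the first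
    \<open>N = k + d\<close>.\<close>
  define N m where "N = k + d" and "m = N + r"
  let ?M = "multisamples M m"
  interpret P: prob_space ?M
    by (intro prob_space_PiM prob_space_axioms)
  \<comment> \<open>The samples in \<open>J\<close> are left out because the product formula needs
    indices outside \<open>J\<close>; \<open>consistent_own\<close> restores them in
    \<open>E_iff\<close>.\<close>
  define E where "E J = pattern_event {1..m} J ({1..N} - J) {} UNIV" for J
  define Ir where "Ir = {N + 1..m}"
  have Ir: "Ir \<in> [{1..m}]\<^bsup>r\<^esup>" "{1..m} - Ir = {1..N}"
    by (auto simp: Ir_def nsets_def m_def)
  have m: "d + r \<le> m" by (simp add: m_def N_def)
  have fin: "finite ([{1..N}]\<^bsup>d\<^esup>)"
    by (intro finite_imp_finite_nsets) auto
  have J: "J \<subseteq> {1..m}" "card J = d" "finite J" "J \<subseteq> {1..N}" if "J \<in> [{1..N}]\<^bsup>d\<^esup>" for J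
    using that by (auto simp: nsets_def m_def)
  have E_iff: "\<omega> \<in> E J \<longleftrightarrow> consistent T \<omega> {1..N} (G (labeled T \<omega> J))"
    if "\<omega> \<in> space ?M" "J \<in> [{1..N}]\<^bsup>d\<^esup>" for \<omega> J
  proof -
    have "consistent T \<omega> J (G (labeled T \<omega> J))"
      by (rule consistent_own[OF m that(1) Ir(1)]) (use that Ir in simp)
    then have "consistent T \<omega> {1..N} (G (labeled T \<omega> J)) \<longleftrightarrow>
        consistent T \<omega> ({1..N} - J) (G (labeled T \<omega> J))"
      by (auto simp: consistent_def)
    moreover have sub: "{1..N} - J \<subseteq> {1..m}"
      by (auto simp: m_def)
    ultimately show ?thesis
      using consistent_iff[OF that(1) J(2)[OF that(2)], of "{1..N} - J"] that(1)
      by (simp add: E_def pattern_event_def sub)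
  qed
  have E_sets: "E J \<in> sets ?M" if "J \<in> [{1..N}]\<^bsup>d\<^esup>" for J
    unfolding E_def using J[OF that] by (intro pattern_event_sets) (auto simp: m_def)
  have "AE \<omega> in ?M. (\<Sum>J\<in>[{1..N}]\<^bsup>d\<^esup>. indicator (E J) \<omega>) = (1::real)"
    using unique_consistent[OF m] AE_space
  proof eventually_elim
    case (elim \<omega>)
    have ex1: "\<exists>!J. J \<in> [{1..N}]\<^bsup>d\<^esup> \<and> consistent T \<omega> {1..N} (G (labeled T \<omega> J))"
      using bspec[OF elim(1) Ir(1)] unfolding Ir(2) .
    obtain J0 where J0: "J0 \<in> [{1..N}]\<^bsup>d\<^esup>" "consistent T \<omega> {1..N} (G (labeled T \<omega> J0))"
      and J0_unique: "\<And>J. J \<in> [{1..N}]\<^bsup>d\<^esup> \<Longrightarrow> consistent T \<omega> {1..N} (G (labeled T \<omega> J)) \<Longrightarrow> J = J0"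
      by (rule ex1E[OF ex1]) blast
    have "(\<Sum>J\<in>[{1..N}]\<^bsup>d\<^esup>. indicator (E J) \<omega>) = (\<Sum>J\<in>[{1..N}]\<^bsup>d\<^esup>. if J = J0 then 1 else 0 :: real)"
    proof (rule sum.cong[OF refl])
      fix J assume J': "J \<in> [{1..N}]\<^bsup>d\<^esup>"
      have "\<omega> \<in> E J \<longleftrightarrow> J = J0"
        unfolding E_iff[OF elim(2) J'] using J' J0(2) J0_unique by blast
      then show "indicator (E J) \<omega> = (if J = J0 then 1 else 0 :: real)"
        by (simp add: indicator_def)
    qed
    also have "\<dots> = 1" using J0 fin by simp
    finally show ?case .
  qed
  then have "(\<integral>\<omega>. (\<Sum>J\<in>[{1..N}]\<^bsup>d\<^esup>. indicator (E J) \<omega> :: real) \<partial>?M) = (\<integral>\<omega>. 1 \<partial>?M)"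
    using E_sets by (intro integral_cong_AE) auto
  also have "\<dots> = 1"
    using P.prob_space by simp
  finally have "1 = (\<integral>\<omega>. (\<Sum>J\<in>[{1..N}]\<^bsup>d\<^esup>. indicator (E J) \<omega> :: real) \<partial>?M)"
    by (rule sym)
  also have "\<dots> = (\<Sum>J\<in>[{1..N}]\<^bsup>d\<^esup>. \<integral>\<omega>. indicator (E J) \<omega> \<partial>?M)"
    using E_sets by (intro Bochner_Integration.integral_sum P.integrable_const_bound[where B = 1]) auto
  also have "\<dots> = (\<Sum>J\<in>[{1..N}]\<^bsup>d\<^esup>. P.prob (E J))"
    using E_sets by (intro sum.cong) simp_all
  also have "\<dots> = (\<Sum>J\<in>[{1..N}]\<^bsup>d\<^esup>. \<integral>x. (1 - S_prob x) ^ k \<partial>samples)"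
  proof (rule sum.cong[OF refl])
    fix J assume J': "J \<in> [{1..N}]\<^bsup>d\<^esup>"
    have "card ({1..N} - J) = k"
      using J[OF J'] by (simp add: card_Diff_subset N_def)
    then show "P.prob (E J) = (\<integral>x. (1 - S_prob x) ^ k \<partial>samples)"
      unfolding E_def using J[OF J'] by (subst measure_pattern_event) (auto simp: m_def)
  qed
  also have "\<dots> = real ((k + d) choose d) * (\<integral>x. (1 - S_prob x) ^ k \<partial>samples)"
    by (simp add: card_nsets N_def)
  finally show ?thesis by simp
qed

text \<open>The selected sets witness that the event is covered by pattern events, one for each pair
  of disjoint defining and mislabeled sets. All of these have the same probability \<open>c\<close>,
  so the bound is their number times \<open>c\<close>.\<close>

lemma error_probability_bound:
  assumes m: "d + r \<le> m" and \<epsilon>: "0 < \<epsilon>" "\<epsilon> < 1"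
    and selection: "AE \<omega> in multisamples M m. \<omega> \<in> E \<longrightarrow>
      (\<exists>Ir \<in> [{1..m}]\<^bsup>r\<^esup>. \<exists>Id \<in> [{1..m} - Ir]\<^bsup>d\<^esup>.
        consistent T \<omega> ({1..m} - Ir) (G (labeled T \<omega> Id)) \<and>
        mislabels_all T \<omega> Ir (G (labeled T \<omega> Id)) \<and>
        concept_error M T (G (labeled T \<omega> Id)) > \<epsilon>)"
  shows "measure (multisamples M m) E \<le>
    real ((r + d - 1) choose r) * (\<Sum>i = 0..r + d - 1. real (m choose i) * \<epsilon> ^ i * (1 - \<epsilon>) ^ (m - i))"
proof -
  let ?M = "multisamples M m" and ?l = "m - d - r"
  interpret P: prob_space ?M
    by (intro prob_space_PiM prob_space_axioms)
  \<comment> \<open>The defining set \<open>J\<close> comes first here, in contrast to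
    \<open>selection\<close>; disjointness is symmetric, and this order fits the count
    \<open>(m choose d) * ((m - d) choose r)\<close>.\<close>
  define Q where "Q = (SIGMA J:[{1..m}]\<^bsup>d\<^esup>. [{1..m} - J]\<^bsup>r\<^esup>)"
  \<comment> \<open>Weakening the strict error inequality to the closed half-line matches the closed
    interval of the tail integral.\<close>
  define F where "F = (\<lambda>(J, I). pattern_event {1..m} J ({1..m} - J - I) I {\<epsilon>..})"
  define c where "c = real d * (1 - binomial_cdf m ?l (1 - \<epsilon>)) / (real (r + d) * real (m choose ?l))"
  have finQ: "finite Q"
    unfolding Q_def by (intro finite_SigmaI finite_imp_finite_nsets) auto
  have Q: "J \<subseteq> {1..m}" "I \<subseteq> {1..m} - J" "card J = d" "card I = r" "finite J" "finite I" if "(J, I) \<in> Q" for J I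
    using that by (auto simp: Q_def nsets_def)
  have F_sets: "F z \<in> sets ?M" if "z \<in> Q" for z
  proof -
    obtain J I where [simp]: "z = (J, I)" by fastforce
    note JI = Q[OF that[simplified]]
    show ?thesis
      unfolding F_def prod.case \<open>z = (J, I)\<close> using JI(1,2,3)
      by (intro pattern_event_sets) auto
  qed
  have F_prob: "P.prob (F z) = c" if z: "z \<in> Q" for z
  proof -
    obtain J I where [simp]: "z = (J, I)" by fastforce
    note JI = Q[OF z[simplified]]
    have "card ({1..m} - J - I) = ?l"
      using JI by (simp add: card_Diff_subset)
    moreover have "?l + r + d = m" using m by simp
    ultimately show ?thesis
      unfolding F_def using JI
        S_prob_tail_integral[OF d_pos \<epsilon> distr_S_prob[OF d_pos survival_moment], of ?l r]
      by (simp add: c_def, subst measure_pattern_event) auto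
  qed
  have "AE \<omega> in ?M. \<omega> \<in> E \<longrightarrow> \<omega> \<in> (\<Union>z\<in>Q. F z)"
    using selection AE_space
  proof eventually_elim
    case (elim \<omega>)
    show ?case
    proof
      assume "\<omega> \<in> E"
      then obtain I J where IJ: "I \<in> [{1..m}]\<^bsup>r\<^esup>" "J \<in> [{1..m} - I]\<^bsup>d\<^esup>"
        and con: "consistent T \<omega> ({1..m} - I) (G (labeled T \<omega> J))"
        and mis: "mislabels_all T \<omega> I (G (labeled T \<omega> J))"
        and err: "concept_error M T (G (labeled T \<omega> J)) > \<epsilon>"
        using elim(1) by blast
      have J: "card J = d" and "(J, I) \<in> Q"
        using IJ by (auto simp: Q_def nsets_def)
      moreover have "\<omega> \<in> F (J, I)"
        using con mis err elim(2) IJ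
          consistent_iff[OF elim(2) J, of "{1..m} - I"] mislabels_all_iff[OF elim(2) J, of I]
        by (auto simp: F_def pattern_event_def concept_error_eq[OF J] nsets_def)
      ultimately show "\<omega> \<in> (\<Union>z\<in>Q. F z)" by blast
    qed
  qed
  then have "P.prob E \<le> P.prob (\<Union>z\<in>Q. F z)"
    using finQ F_sets by (intro P.finite_measure_mono_AE) auto
  also have "\<dots> \<le> (\<Sum>z\<in>Q. P.prob (F z))"
    using finQ F_sets by (intro P.finite_measure_subadditive_finite) auto
  also have "\<dots> = real (card Q) * c"
    using F_prob by simp
  also have "card Q = (\<Sum>J\<in>[{1..m}]\<^bsup>d\<^esup>. card ([{1..m} - J]\<^bsup>r\<^esup>))"
    unfolding Q_def by (intro card_SigmaI) (auto intro!: finite_imp_finite_nsets)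
  also have "\<dots> = (\<Sum>J\<in>[{1..m}]\<^bsup>d\<^esup>. (m - d) choose r)"
  proof (rule sum.cong[OF refl])
    fix J assume "J \<in> [{1..m}]\<^bsup>d\<^esup>"
    then have "card ({1..m} - J) = m - d"
      by (simp add: nsets_def card_Diff_subset)
    then show "card ([{1..m} - J]\<^bsup>r\<^esup>) = (m - d) choose r"
      by (simp add: card_nsets)
  qed
  also have "\<dots> = (m choose d) * ((m - d) choose r)"
    by (simp add: card_nsets)
  also have "real \<dots> * c = real ((r + d - 1) choose r) * (1 - binomial_cdf m ?l (1 - \<epsilon>))"
  proof -
    have pos: "real (r + d) * real (m choose ?l) \<noteq> 0"
      using d_pos by simp
    have "real ((m choose d) * ((m - d) choose r)) * c
        = real (m choose d) * real ((m - d) choose r) * real d * (1 - binomial_cdf m ?l (1 - \<epsilon>))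
          / (real (r + d) * real (m choose ?l))"
      by (simp add: c_def)
    then show ?thesis
      unfolding choose_disjoint_pairs[OF d_pos m] using pos by simp
  qed
  \<comment> \<open>Reflection with \<open>k = r + d\<close>, for which \<open>m - k\<close> is
    \<open>?l\<close>.\<close>
  also have "1 - binomial_cdf m ?l (1 - \<epsilon>)
      = (\<Sum>i = 0..r + d - 1. real (m choose i) * \<epsilon> ^ i * (1 - \<epsilon>) ^ (m - i))"
    using binomial_cdf_reflect[of "r + d" m \<epsilon>] m d_pos by (simp add: diff_diff_eq add.commute)
  finally show ?thesis .
qed

end

theorem theorem5:
  fixes M :: "(real ^ 'n) measure"
    and T :: "(real ^ 'n) set"
    and r d :: nat
    and G :: "((real ^ 'n) \<times> bool) list \<Rightarrow> (real ^ 'n) set"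
    and Ibar mbar :: "((real ^ 'n) \<times> bool) list \<Rightarrow> nat set"
    and A :: "nat \<Rightarrow> ((real ^ 'n) \<times> bool) list \<Rightarrow> (real ^ 'n) set"
  assumes "prob_space M"
    and "T \<in> sets M"
    and "r > 0" and "d > 0"
    and "G \<in> labeled_lists M d \<rightarrow> sets M"
    and measurable_consistent:
      "\<And>m J K. m \<ge> d + r \<Longrightarrow> J \<in> [{1..m}]\<^bsup>d\<^esup> \<Longrightarrow> K \<subseteq> {1..m} \<Longrightarrow>
         {\<omega> \<in> space (multisamples M m). consistent T \<omega> K (G (labeled T \<omega> J))}
           \<in> sets (multisamples M m)"
    and consistent_own:
      "\<And>m \<omega> Ir Id. m \<ge> d + r \<Longrightarrow> \<omega> \<in> space (multisamples M m) \<Longrightarrow>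
         Ir \<in> [{1..m}]\<^bsup>r\<^esup> \<Longrightarrow> Id \<in> [{1..m} - Ir]\<^bsup>d\<^esup> \<Longrightarrow>
         consistent T \<omega> Id (G (labeled T \<omega> Id))"
    and unique_consistent:
      "\<And>m. m \<ge> d + r \<Longrightarrow>
         AE \<omega> in multisamples M m. \<forall>Ir \<in> [{1..m}]\<^bsup>r\<^esup>.
           \<exists>!Id. Id \<in> [{1..m} - Ir]\<^bsup>d\<^esup> \<and> consistent T \<omega> ({1..m} - Ir) (G (labeled T \<omega> Id))"
    and exists_mislabeled:
      "\<And>m. m \<ge> d + r \<Longrightarrow>
         AE \<omega> in multisamples M m. \<exists>Ir \<in> [{1..m}]\<^bsup>r\<^esup>. \<exists>Id \<in> [{1..m} - Ir]\<^bsup>d\<^esup>.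
           consistent T \<omega> ({1..m} - Ir) (G (labeled T \<omega> Id)) \<and>
           mislabels_all T \<omega> Ir (G (labeled T \<omega> Id))"
    and Ibar_mbar_index_sets:
      "\<And>m \<omega>. m \<ge> d + r \<Longrightarrow> \<omega> \<in> space (multisamples M m) \<Longrightarrow>
         Ibar (labeled T \<omega> {1..m}) \<in> [{1..m}]\<^bsup>r\<^esup> \<and>
         mbar (labeled T \<omega> {1..m}) \<in> [{1..m} - Ibar (labeled T \<omega> {1..m})]\<^bsup>d\<^esup>"
    and Ibar_mbar_selection:
      "\<And>m. m \<ge> d + r \<Longrightarrow>
         AE \<omega> in multisamples M m.
           consistent T \<omega> ({1..m} - Ibar (labeled T \<omega> {1..m}))
             (G (labeled T \<omega> (mbar (labeled T \<omega> {1..m})))) \<and>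
           mislabels_all T \<omega> (Ibar (labeled T \<omega> {1..m}))
             (G (labeled T \<omega> (mbar (labeled T \<omega> {1..m}))))"
    and "learning_algorithm M (d + r) A"
    and "\<And>m \<omega>. m \<ge> d + r \<Longrightarrow> \<omega> \<in> space (multisamples M m) \<Longrightarrow>
         A m (labeled T \<omega> {1..m}) = G (labeled T \<omega> (mbar (labeled T \<omega> {1..m})))"
    and measurable_error:
      "\<And>m \<epsilon>. m \<ge> d + r \<Longrightarrow> \<epsilon> \<in> {0<..<1} \<Longrightarrow>
         error_event M T A m \<epsilon> \<in> sets (multisamples M m)"
  shows "PAC_T M T (d + r) A
           (\<lambda>m \<epsilon>. real ((r + d - 1) choose r) *
                    (\<Sum>i = 0..r + d - 1. real (m choose i) * \<epsilon> ^ i * (1 - \<epsilon>) ^ (m - i)))"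
proof -
  interpret consistent_learner M T r d G
    by (intro consistent_learner.intro consistent_learner_axioms.intro assms(1,3,4)
        measurable_consistent consistent_own unique_consistent)
  have "measure (multisamples M m) (error_event M T A m \<epsilon>) \<le>
      real ((r + d - 1) choose r) * (\<Sum>i = 0..r + d - 1. real (m choose i) * \<epsilon> ^ i * (1 - \<epsilon>) ^ (m - i))"
    if \<epsilon>: "\<epsilon> \<in> {0<..<1}" and m: "d + r \<le> m" for \<epsilon> m
  proof (rule error_probability_bound[OF m])
    show "AE \<omega> in multisamples M m. \<omega> \<in> error_event M T A m \<epsilon> \<longrightarrow>
      (\<exists>Ir \<in> [{1..m}]\<^bsup>r\<^esup>. \<exists>Id \<in> [{1..m} - Ir]\<^bsup>d\<^esup>.
        consistent T \<omega> ({1..m} - Ir) (G (labeled T \<omega> Id)) \<and>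
        mislabels_all T \<omega> Ir (G (labeled T \<omega> Id)) \<and>
        concept_error M T (G (labeled T \<omega> Id)) > \<epsilon>)"
      using Ibar_mbar_selection[OF m] AE_space
    proof eventually_elim
      case (elim \<omega>)
      show ?case
      proof (intro impI bexI conjI)
        \<comment> \<open>The existential witnesses are still schematic; they become the values of
          \<open>Ibar\<close> and \<open>mbar\<close> at the full labeled multisample, for which the
          output of \<open>A m\<close> is the selected hypothesis.\<close>
        assume "\<omega> \<in> error_event M T A m \<epsilon>"
        then show "concept_error M T (G (labeled T \<omega> (mbar (labeled T \<omega> {1..m})))) > \<epsilon>"
          using assms(13)[OF m elim(2)] by (simp add: error_event_def)
      qed (use elim(1) Ibar_mbar_index_sets[OF m elim(2)] in auto)
    qed
  qed (use \<epsilon> in auto)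
  moreover have "(\<lambda>m. real ((r + d - 1) choose r) *
      (\<Sum>i = 0..r + d - 1. real (m choose i) * \<epsilon> ^ i * (1 - \<epsilon>) ^ (m - i))) \<longlonglongrightarrow> 0"
    if "\<epsilon> \<in> {0<..<1}" for \<epsilon> :: real
    using that by (intro tendsto_mult_right_zero binomial_lower_tail_tendsto_0) auto
  ultimately show ?thesis
    by (simp add: PAC_T_def)
qed

end
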